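(* For connected graphs $G$ and $H$, consider the following conditions: (a) $G$ and $H$ are isomorphic. (b) $G$ and $H$ are orbitally similar and have the same order. (c) $G$ and $H$ are orbitally similar. (d) $G$ and $H$ have the same orbit distribution vector, i.e. $\omega(G)=\omega(H)$. (e) $G$ and $H$ have the same entropy, i.e. $\mathrm{Ent}(G)=\mathrm{Ent}(H)$. Each of these conditions implies the next one: for all connected graphs $G,H$, (a) $\Rightarrow$ (b) $\Rightarrow$ (c) $\Rightarrow$ (d) $\Rightarrow$ (e). Moreover, none of the conditions (a), (b), (c), (d) is implied by the next one: for each of the four consecutive pairs of conditions there exist connected graphs $G,H$ satisfying the latter condition but not the former.
   Context: All graphs are finite, undirected, without loops and multiple edges. $V_G$ is the vertex set of $G$ and $|G|=|V_G|$ is its order. Two vertices $u,v$ of $G$ are automorphically similar if $\varphi(u)=v$ for some automorphism $\varphi$ of $G$; the equivalence classes $\mathcal O_1,\ldots,\mathcal O_\ell$ are the orbits of $G$. Given an ordering $(\mathcal O_1,\ldots,\mathcal O_\ell)$ of the orbits, the orbit divisor matrix of $G$ is $S_G=[s_{i,j}]_{i,j=1}^{\ell}$, where $s_{i,j}$ is the number of vertices in $\mathcal O_j$ adjacent to a vertex $u\in\mathcal O_i$ (this does not depend on the choice of $u\in\mathcal O_i$). Two connected graphs $G$ and $H$, possibly of different order, are orbitally similar if they have the same number of orbits and $S_G=S_H$ for suitable orderings of the orbits of $G$ and of the orbits of $H$. The orbit distribution vector of $G$ is $\omega(G)=\left(|\mathcal O_1|/|G|,\ldots,|\mathcal O_\ell|/|G|\right)^{\downarrow}$,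 where $\xi^{\downarrow}$ denotes the nonincreasing rearrangement of $\xi\in\mathbb R^\ell$. The entropy of $G$ is $\mathrm{Ent}(G)=-\sum_{i=1}^{\ell}\omega_i\log_2\omega_i$, where $\omega(G)=(\omega_1,\ldots,\omega_\ell)$. *)

theory Defs
  imports
    Complex_Main
    "HOL-Library.Multiset"
    "Graph_Theory.Pair_Digraph"
    "Graph_Theory.Digraph_Component"
    "Graph_Theory.Digraph_Isomorphism"
    "Jordan_Normal_Form.Matrix"
begin

text \<open>Following the library, an undirected edge $uv$ is represented by the two arcs
  $(u,v)$ and $(v,u)$; the locale \<^locale>\<open>pair_graph\<close> then describes finite graphs without
  loops and multiple edges. The qualified name avoids topological connectedness; the library
  notion also requires a nonempty vertex set.\<close>

definition connected_graph :: "'a pair_pre_digraph \<Rightarrow> bool" where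
  "connected_graph G \<longleftrightarrow> pair_graph G \<and> Digraph_Component.connected (with_proj G)"

definition graph_order :: "'a pair_pre_digraph \<Rightarrow> nat" where
  "graph_order G = card (pverts G)"

definition isomorphic :: "'a pair_pre_digraph \<Rightarrow> 'b pair_pre_digraph \<Rightarrow> bool" where
  "isomorphic G H \<longleftrightarrow> digraph_iso (with_proj G) (with_proj H)"

definition graph_isomorphism ::
    "'a pair_pre_digraph \<Rightarrow> 'b pair_pre_digraph \<Rightarrow> ('a \<Rightarrow> 'b) \<Rightarrow> bool" where
  "graph_isomorphism G H \<phi> \<longleftrightarrow>
     bij_betw \<phi> (pverts G) (pverts H) \<and>
     (\<forall>u\<in>pverts G. \<forall>v\<in>pverts G. (u, v) \<in> parcs G \<longleftrightarrow> (\<phi> u, \<phi> v) \<in> parcs H)"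

lemma isomorphic_iff:
  fixes G :: "'a pair_pre_digraph" and H :: "'b pair_pre_digraph"
  assumes "pair_graph G" "pair_graph H"
  shows "isomorphic G H \<longleftrightarrow> (\<exists>\<phi>. graph_isomorphism G H \<phi>)"
proof -
  interpret G: pair_graph G by fact
  interpret H: pair_graph H by fact
  have "\<exists>\<phi>. graph_isomorphism G H \<phi>" if "isomorphic G H"
  proof -
    from that obtain f where f: "pre_digraph.digraph_isomorphism (with_proj G) f"
      and H: "with_proj H = app_iso f (with_proj G)"
      by (auto simp: isomorphic_def digraph_iso_def)
    have V: "pverts H = iso_verts f ` pverts G"
      and A: "parcs H = iso_arcs f ` parcs G"
      and t: "iso_tail f = fst" and h: "iso_head f = snd"
      using H by (simp_all add: with_proj_def app_iso_def)
    have inj: "inj_on (iso_verts f) (pverts G)"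
      and e: "\<And>a. a \<in> parcs G \<Longrightarrow> iso_arcs f a = (iso_verts f (fst a), iso_verts f (snd a))"
      using f t h by (auto simp: pre_digraph.digraph_isomorphism_def prod_eq_iff)
    have "graph_isomorphism G H (iso_verts f)"
      unfolding graph_isomorphism_def
    proof (intro conjI ballI iffI)
      show "bij_betw (iso_verts f) (pverts G) (pverts H)"
        using V inj by (simp add: bij_betw_def)
    next
      fix u v assume "(u, v) \<in> parcs G"
      then show "(iso_verts f u, iso_verts f v) \<in> parcs H"
        using A e[of "(u, v)"] by (metis fst_conv image_eqI snd_conv)
    next
      fix u v assume uv: "u \<in> pverts G" "v \<in> pverts G"
        and "(iso_verts f u, iso_verts f v) \<in> parcs H"
      then obtain a where a: "a \<in> parcs G" "iso_arcs f a = (iso_verts f u, iso_verts f v)"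
        using A by auto
      then have "fst a = u" "snd a = v"
        using e[OF a(1)] uv inj G.arc_fst_in_verts G.arc_snd_in_verts
        by (auto dest: inj_onD)
      then show "(u, v) \<in> parcs G" using a(1) by auto
    qed
    then show ?thesis by blast
  qed
  moreover have "isomorphic G H" if "\<exists>\<phi>. graph_isomorphism G H \<phi>"
  proof -
    from that obtain \<phi> where phi: "graph_isomorphism G H \<phi>" ..
    define f :: "('a, 'a \<times> 'a, 'b, 'b \<times> 'b) digraph_isomorphism" where
      "f = \<lparr>iso_verts = \<phi>, iso_arcs = map_prod \<phi> \<phi>, iso_head = snd, iso_tail = fst\<rparr>"
    have inj: "inj_on \<phi> (pverts G)" and im: "\<phi> ` pverts G = pverts H"
      using phi by (auto simp: graph_isomorphism_def bij_betw_def)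
    have sub: "parcs G \<subseteq> pverts G \<times> pverts G"
      using G.in_arcsD1 G.in_arcsD2 by auto
    have "pre_digraph.digraph_isomorphism (with_proj G) f"
      using inj G.wf_digraph inj_on_subset[OF map_prod_inj_on[OF inj inj] sub]
      by (auto simp: pre_digraph.digraph_isomorphism_def f_def)
    moreover have "parcs H = map_prod \<phi> \<phi> ` parcs G"
    proof (intro equalityI subsetI)
      fix e assume e: "e \<in> parcs H"
      then have "fst e \<in> \<phi> ` pverts G" "snd e \<in> \<phi> ` pverts G"
        using im H.arc_fst_in_verts H.arc_snd_in_verts by auto
      then obtain u v where "u \<in> pverts G" "v \<in> pverts G" "e = (\<phi> u, \<phi> v)"
        by (metis imageE prod.collapse)
      then show "e \<in> map_prod \<phi> \<phi> ` parcs G"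
        using e phi by (force simp: graph_isomorphism_def)
    next
      fix e assume "e \<in> map_prod \<phi> \<phi> ` parcs G"
      then show "e \<in> parcs H"
        using phi sub by (auto simp: graph_isomorphism_def)
    qed
    then have "with_proj H = app_iso f (with_proj G)"
      using im by (simp add: app_iso_def f_def with_proj_def)
    ultimately show ?thesis
      unfolding isomorphic_def digraph_iso_def by blast
  qed
  ultimately show ?thesis by blast
qed

definition aut_similar :: "'a pair_pre_digraph \<Rightarrow> 'a rel" where
  "aut_similar G =
     {(u, v) \<in> pverts G \<times> pverts G. \<exists>\<phi>. graph_isomorphism G G \<phi> \<and> \<phi> u = v}"

definition orbits :: "'a pair_pre_digraph \<Rightarrow> 'a set set" where
  "orbits G = pverts G // aut_similar G"

lemma equiv_aut_similar: "equiv (pverts G) (aut_similar G)"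
proof (rule equivI)
  show "aut_similar G \<subseteq> pverts G \<times> pverts G" by (auto simp: aut_similar_def)
  have "graph_isomorphism G G (\<lambda>x. x)"
    by (auto simp: graph_isomorphism_def bij_betw_def)
  then show "refl_on (pverts G) (aut_similar G)"
    by (auto simp: refl_on_def aut_similar_def)
  show "sym (aut_similar G)"
  proof (rule symI)
    fix u v assume "(u, v) \<in> aut_similar G"
    then obtain \<phi> where uv: "u \<in> pverts G" "v \<in> pverts G" "\<phi> u = v"
      and phi: "graph_isomorphism G G \<phi>" by (auto simp: aut_similar_def)
    let ?i = "inv_into (pverts G) \<phi>"
    from phi have b: "bij_betw \<phi> (pverts G) (pverts G)" by (simp add: graph_isomorphism_def)
    have i: "?i x \<in> pverts G" "\<phi> (?i x) = x" if "x \<in> pverts G" for x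
      using bij_betw_inv_into[OF b] bij_betw_inv_into_right[OF b] that
      by (auto simp: bij_betw_def)
    have "graph_isomorphism G G ?i"
      using bij_betw_inv_into[OF b] phi i by (simp add: graph_isomorphism_def)
    moreover have "?i v = u" using bij_betw_inv_into_left[OF b] uv by auto
    ultimately show "(v, u) \<in> aut_similar G" using uv by (auto simp: aut_similar_def)
  qed
  show "trans (aut_similar G)"
  proof (rule transI)
    fix u v w assume "(u, v) \<in> aut_similar G" "(v, w) \<in> aut_similar G"
    then obtain \<phi> \<psi> where uw: "u \<in> pverts G" "w \<in> pverts G" "\<psi> (\<phi> u) = w"
      and iso: "graph_isomorphism G G \<phi>" "graph_isomorphism G G \<psi>"
      by (auto simp: aut_similar_def)
    then have "bij_betw (\<psi> \<circ> \<phi>) (pverts G) (pverts G)"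
      by (auto simp: graph_isomorphism_def intro: bij_betw_trans)
    moreover have "\<phi> x \<in> pverts G" if "x \<in> pverts G" for x
      using iso that by (auto simp: graph_isomorphism_def bij_betw_def)
    ultimately have "graph_isomorphism G G (\<psi> \<circ> \<phi>)"
      using iso unfolding graph_isomorphism_def comp_def by blast
    then show "(u, w) \<in> aut_similar G" using uw by (auto simp: aut_similar_def)
  qed
qed

definition orbit_ordering :: "'a pair_pre_digraph \<Rightarrow> 'a set list \<Rightarrow> bool" where
  "orbit_ordering G Os \<longleftrightarrow> distinct Os \<and> set Os = orbits G"

definition adjacent_in :: "'a pair_pre_digraph \<Rightarrow> 'a \<Rightarrow> 'a set \<Rightarrow> nat" where
  "adjacent_in G u B = card {w \<in> B. (u, w) \<in> parcs G}"

definition orbit_divisor_matrix :: "'a pair_pre_digraph \<Rightarrow> 'a set list \<Rightarrow> nat mat" where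
  "orbit_divisor_matrix G Os =
     mat (length Os) (length Os) (\<lambda>(i, j). adjacent_in G (SOME u. u \<in> Os ! i) (Os ! j))"

text \<open>The entries do not depend on the chosen representatives.\<close>

lemma adjacent_in_orbit_eq:
  assumes "A \<in> orbits G" "B \<in> orbits G" "u \<in> A" "v \<in> A"
  shows "adjacent_in G u B = adjacent_in G v B"
proof -
  have "(u, v) \<in> aut_similar G"
    using assms equiv_aut_similar[of G] unfolding orbits_def
    by (metis quotient_eq_iff)
  then obtain \<phi> where u: "u \<in> pverts G" and v: "v = \<phi> u" and phi: "graph_isomorphism G G \<phi>"
    by (auto simp: aut_similar_def)
  have b: "bij_betw \<phi> (pverts G) (pverts G)" using phi by (simp add: graph_isomorphism_def)
  have BV: "B \<subseteq> pverts G"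
    using assms(2) equiv_aut_similar[of G] unfolding orbits_def
    by (metis Union_quotient Union_upper)
  have inv: "\<phi> w \<in> B \<longleftrightarrow> w \<in> B" if "w \<in> pverts G" for w
  proof -
    have "\<phi> w \<in> pverts G" using b that by (auto simp: bij_betw_def)
    then have "(w, \<phi> w) \<in> aut_similar G" using that phi by (auto simp: aut_similar_def)
    then show ?thesis
      using assms(2) equiv_aut_similar[of G] unfolding orbits_def
      by (meson in_quotient_imp_closed equivE symE)
  qed
  have "bij_betw \<phi> {w \<in> B. (u, w) \<in> parcs G} {w \<in> B. (v, w) \<in> parcs G}"
    unfolding bij_betw_def
  proof (intro conjI equalityI subsetI)
    show "inj_on \<phi> {w \<in> B. (u, w) \<in> parcs G}"
      using b BV by (auto simp: bij_betw_def intro: inj_on_subset)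
  next
    fix x assume "x \<in> \<phi> ` {w \<in> B. (u, w) \<in> parcs G}"
    then show "x \<in> {w \<in> B. (v, w) \<in> parcs G}"
      using u v BV phi inv by (auto simp: graph_isomorphism_def)
  next
    fix x assume x: "x \<in> {w \<in> B. (v, w) \<in> parcs G}"
    then obtain w where w: "w \<in> pverts G" "x = \<phi> w"
      using BV b by (auto simp: bij_betw_def)
    then have "w \<in> {w \<in> B. (u, w) \<in> parcs G}"
      using x u v phi inv by (auto simp: graph_isomorphism_def)
    then show "x \<in> \<phi> ` {w \<in> B. (u, w) \<in> parcs G}" using w by blast
  qed
  then show ?thesis unfolding adjacent_in_def by (rule bij_betw_same_card)
qed

lemma orbit_divisor_matrix_index:
  assumes "orbit_ordering G Os" "i < length Os" "j < length Os" "u \<in> Os ! i"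
  shows "orbit_divisor_matrix G Os $$ (i, j) = adjacent_in G u (Os ! j)"
proof -
  have "Os ! i \<in> orbits G" "Os ! j \<in> orbits G"
    using assms by (auto simp: orbit_ordering_def dest: nth_mem)
  moreover have "(SOME u. u \<in> Os ! i) \<in> Os ! i" using assms(4) by (rule someI)
  ultimately show ?thesis
    using assms adjacent_in_orbit_eq[of "Os ! i" G "Os ! j" "SOME u. u \<in> Os ! i" u]
    by (simp add: orbit_divisor_matrix_def)
qed

definition orbitally_similar :: "'a pair_pre_digraph \<Rightarrow> 'b pair_pre_digraph \<Rightarrow> bool" where
  "orbitally_similar G H \<longleftrightarrow>
     card (orbits G) = card (orbits H) \<and>
     (\<exists>Os Ps. orbit_ordering G Os \<and> orbit_ordering H Ps \<and>
        orbit_divisor_matrix G Os = orbit_divisor_matrix H Ps)"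

text \<open>The multiset keeps repeated values: distinct orbits of the same size contribute
  separate components.\<close>

definition orbit_distribution :: "'a pair_pre_digraph \<Rightarrow> real list" where
  "orbit_distribution G =
     rev (sorted_list_of_multiset
       (image_mset (\<lambda>A. real (card A) / real (graph_order G)) (mset_set (orbits G))))"

definition graph_entropy :: "'a pair_pre_digraph \<Rightarrow> real" where
  "graph_entropy G = - (\<Sum>x\<leftarrow>orbit_distribution G. x * log 2 x)"

end

theory Submission
  imports Defs "HOL-Combinatorics.Transposition" "HOL-Number_Theory.Cong"
begin

text \<open>Isomorphisms map orbits to orbits and preserve the numbers $s_{i,j}$. For (c) implies (d),
  double counting the edges between two orbits gives
  $|\mathcal O_i|\, s_{i,j} = |\mathcal O_j|\, s_{j,i}$. By connectivity these equations determine
  the orbit sizes up to a common factor, hence the orbit distribution.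

  The circulant graphs on 8 vertices with connection sets $\pm\{1,2\}$ and $\pm\{1,3\}$ separate
  (a) from (b), since only the second is bipartite; the cycles $C_3$ and $C_4$ separate (b) from
  (c), and $K_1$ and $K_2$ separate (c) from (d). Finally, orbit sizes $2,2,2,2$ and $4,1,1,1,1$ on
  8 vertices both give entropy 2; they are realised by a half graph and a threshold graph whose
  orbits are exactly the classes of vertices of equal degree.\<close>

section \<open>Isomorphisms and orbits\<close>

lemma graph_isomorphism_comp:
  assumes "graph_isomorphism G H \<phi>" "graph_isomorphism H K \<psi>"
  shows "graph_isomorphism G K (\<psi> \<circ> \<phi>)"
  unfolding graph_isomorphism_def
proof (intro conjI ballI)
  show "bij_betw (\<psi> \<circ> \<phi>) (pverts G) (pverts K)"
    using assms by (auto simp: graph_isomorphism_def intro: bij_betw_trans)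
  fix u v assume "u \<in> pverts G" "v \<in> pverts G"
  moreover from this have "\<phi> u \<in> pverts H" "\<phi> v \<in> pverts H"
    using assms(1) by (auto simp: graph_isomorphism_def bij_betw_def)
  ultimately show "(u, v) \<in> parcs G \<longleftrightarrow> ((\<psi> \<circ> \<phi>) u, (\<psi> \<circ> \<phi>) v) \<in> parcs K"
    using assms by (simp add: graph_isomorphism_def)
qed

lemma graph_isomorphism_inv_into:
  assumes "graph_isomorphism G H \<phi>"
  shows "graph_isomorphism H G (inv_into (pverts G) \<phi>)"
  unfolding graph_isomorphism_def
proof (intro conjI ballI)
  let ?i = "inv_into (pverts G) \<phi>"
  have b: "bij_betw \<phi> (pverts G) (pverts H)"
    using assms by (simp add: graph_isomorphism_def)
  show i: "bij_betw ?i (pverts H) (pverts G)" using b by (rule bij_betw_inv_into)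
  fix u v assume "u \<in> pverts H" "v \<in> pverts H"
  moreover from this have "?i u \<in> pverts G" "?i v \<in> pverts G"
    using i by (auto simp: bij_betw_def)
  ultimately show "(u, v) \<in> parcs H \<longleftrightarrow> (?i u, ?i v) \<in> parcs G"
    using assms bij_betw_inv_into_right[OF b] by (simp add: graph_isomorphism_def)
qed

text \<open>If an automorphism of \<open>G\<close> takes \<open>u\<close> to \<open>v\<close>, its
  conjugate by the isomorphism is an automorphism of \<open>H\<close> taking \<open>\<phi> u\<close>
  to \<open>\<phi> v\<close>.\<close>

lemma aut_similar_iso:
  assumes phi: "graph_isomorphism G H \<phi>" and "(u, v) \<in> aut_similar G"
  shows "(\<phi> u, \<phi> v) \<in> aut_similar H"
proof -
  let ?i = "inv_into (pverts G) \<phi>"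
  obtain \<psi> where psi: "graph_isomorphism G G \<psi>" "\<psi> u = v" and uv: "u \<in> pverts G" "v \<in> pverts G"
    using assms(2) by (auto simp: aut_similar_def)
  have b: "bij_betw \<phi> (pverts G) (pverts H)"
    using phi by (simp add: graph_isomorphism_def)
  have "graph_isomorphism H H (\<phi> \<circ> (\<psi> \<circ> ?i))"
    using phi psi by (blast intro: graph_isomorphism_comp graph_isomorphism_inv_into)
  moreover have "(\<phi> \<circ> (\<psi> \<circ> ?i)) (\<phi> u) = \<phi> v"
    using psi uv bij_betw_inv_into_left[OF b] by simp
  moreover have "\<phi> u \<in> pverts H" "\<phi> v \<in> pverts H" using b uv by (auto simp: bij_betw_def)
  ultimately show ?thesis unfolding aut_similar_def by blast
qed

lemma orbits_eq: "orbits G = (\<lambda>u. aut_similar G `` {u}) ` pverts G"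
  by (auto simp: orbits_def quotient_def)

text \<open>Transport of similarity along \<open>\<phi>\<close> puts the image of an orbit inside an
  orbit; transport along the inverse shows that this inclusion is an equality.\<close>

lemma orbits_iso:
  assumes phi: "graph_isomorphism G H \<phi>"
  shows "orbits H = (\<lambda>A. \<phi> ` A) ` orbits G"
proof -
  let ?i = "inv_into (pverts G) \<phi>"
  have b: "bij_betw \<phi> (pverts G) (pverts H)"
    using phi by (simp add: graph_isomorphism_def)
  have "\<phi> ` (aut_similar G `` {u}) = aut_similar H `` {\<phi> u}" if u: "u \<in> pverts G" for u
  proof (intro equalityI subsetI)
    fix w assume w: "w \<in> aut_similar H `` {\<phi> u}"
    then have wH: "w \<in> pverts H" by (auto simp: aut_similar_def)
    have "(?i (\<phi> u), ?i w) \<in> aut_similar G"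
      using w by (intro aut_similar_iso[OF graph_isomorphism_inv_into[OF phi]]) auto
    then have "?i w \<in> aut_similar G `` {u}"
      using bij_betw_inv_into_left[OF b u] by simp
    moreover have "\<phi> (?i w) = w" using bij_betw_inv_into_right[OF b wH] .
    ultimately show "w \<in> \<phi> ` (aut_similar G `` {u})" by (metis image_eqI)
  qed (auto intro: aut_similar_iso[OF phi])
  moreover have "pverts H = \<phi> ` pverts G" using b by (simp add: bij_betw_def)
  ultimately show ?thesis unfolding orbits_eq by (force simp: image_image)
qed

lemma Union_orbits: "\<Union> (orbits G) = pverts G"
  unfolding orbits_def using equiv_aut_similar by (rule Union_quotient)

lemma orbit_nonempty: "A \<in> orbits G \<Longrightarrow> A \<noteq> {}"
  unfolding orbits_def by (rule in_quotient_imp_non_empty[OF equiv_aut_similar])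

lemma orbit_subset: "A \<in> orbits G \<Longrightarrow> A \<subseteq> pverts G"
  using Union_upper[of A "orbits G"] by (simp add: Union_orbits)

lemma orbits_disjoint: "A \<in> orbits G \<Longrightarrow> B \<in> orbits G \<Longrightarrow> A \<noteq> B \<Longrightarrow> A \<inter> B = {}"
  using quotient_disj[OF equiv_aut_similar[of G], of A B] by (simp add: orbits_def)

lemma adjacent_in_iso:
  assumes "graph_isomorphism G H \<phi>" "u \<in> pverts G" "B \<subseteq> pverts G"
  shows "adjacent_in H (\<phi> u) (\<phi> ` B) = adjacent_in G u B"
proof -
  have "{w \<in> \<phi> ` B. (\<phi> u, w) \<in> parcs H} = \<phi> ` {w \<in> B. (u, w) \<in> parcs G}"
    using assms unfolding graph_isomorphism_def by blast
  moreover have "inj_on \<phi> {w \<in> B. (u, w) \<in> parcs G}"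
    using assms by (auto simp: graph_isomorphism_def bij_betw_def intro: inj_on_subset)
  ultimately show ?thesis by (simp add: adjacent_in_def card_image)
qed

section \<open>Counting vertices and edges by orbits\<close>

context pair_graph
begin

lemma finite_orbits: "finite (orbits G)"
  using pair_finite_verts by (simp add: orbits_eq)

lemma finite_orbit: "A \<in> orbits G \<Longrightarrow> finite A"
  by (rule finite_subset[OF orbit_subset pair_finite_verts])

lemma arc_sym: "(u, v) \<in> parcs G \<longleftrightarrow> (v, u) \<in> parcs G"
proof -
  have "sym (parcs G)" using pair_sym_arcs by (simp add: symmetric_def)
  then show ?thesis by (auto elim: symE)
qed

lemma orbit_ordering_ex: "\<exists>Os. orbit_ordering G Os"
  using finite_distinct_list[OF finite_orbits] by (auto simp: orbit_ordering_def)

text \<open>The orbits partition the vertex set. This is the normalisation that later turns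
  proportional orbit sizes into equal shares.\<close>

lemma sum_card_orbits:
  assumes "orbit_ordering G Os"
  shows "(\<Sum>i<length Os. card (Os ! i)) = graph_order G"
proof -
  have "graph_order G = (\<Sum>A\<in>orbits G. card A)"
    unfolding graph_order_def Union_orbits[of G, symmetric]
    by (rule card_Union_disjoint) (simp_all add: pairwise_def disjnt_def finite_orbit orbits_disjoint)
  also have "\<dots> = (\<Sum>i<length Os. card (Os ! i))"
    using assms sum.distinct_set_conv_list[of Os card]
    by (simp add: orbit_ordering_def sum_list_sum_nth atLeast0LessThan)
  finally show ?thesis by simp
qed

text \<open>Both sides count the pairs of adjacent vertices with one member in \<open>A\<close> and
  the other in \<open>B\<close>, grouped first by the member in \<open>A\<close> and then by the one
  in \<open>B\<close>. Within an orbit every vertex contributes the same number.\<close>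

lemma orbit_double_counting:
  assumes "A \<in> orbits G" "B \<in> orbits G" "a \<in> A" "b \<in> B"
  shows "card A * adjacent_in G a B = card B * adjacent_in G b A"
proof -
  have fin: "finite A" "finite B" using assms finite_orbit by auto
  have "card A * adjacent_in G a B = (\<Sum>u\<in>A. adjacent_in G u B)"
    using adjacent_in_orbit_eq[OF assms(1,2) _ assms(3)] by simp
  also have "\<dots> = (\<Sum>v\<in>B. adjacent_in G v A)"
    unfolding adjacent_in_def using fin
    by (intro sum_multicount_gen) (auto simp: arc_sym intro: arg_cong[where f = card])
  also have "\<dots> = card B * adjacent_in G b A"
    using adjacent_in_orbit_eq[OF assms(2,1) _ assms(4)] by simp
  finally show ?thesis .
qed

end

text \<open>Any ordering of the orbits of \<open>G\<close>, carried over by an isomorphism, orders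
  the orbits of \<open>H\<close> and yields the same matrix entry by entry.\<close>

lemma isomorphic_imp_orbitally_similar:
  assumes "pair_graph G" "pair_graph H" "isomorphic G H"
  shows "orbitally_similar G H \<and> graph_order G = graph_order H"
proof -
  interpret G: pair_graph G by fact
  interpret H: pair_graph H by fact
  obtain \<phi> where phi: "graph_isomorphism G H \<phi>"
    using assms isomorphic_iff by blast
  have b: "bij_betw \<phi> (pverts G) (pverts H)"
    using phi by (simp add: graph_isomorphism_def)
  obtain Os where Os: "orbit_ordering G Os" using G.orbit_ordering_ex by blast
  \<comment> \<open>Taking images is injective on sets of vertices because \<open>\<phi>\<close> is
    injective on the union of all orbits, which is the vertex set.\<close>
  have inj: "inj_on ((`) \<phi>) (orbits G)"
    using b Union_orbits[of G]
    by (intro inj_on_image) (simp add: bij_betw_def)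
  have Ps: "orbit_ordering H (map ((`) \<phi>) Os)"
    using Os inj by (simp add: orbit_ordering_def distinct_map orbits_iso[OF phi])
  have "orbit_divisor_matrix G Os = orbit_divisor_matrix H (map ((`) \<phi>) Os)"
  proof (rule eq_matI)
    fix i j assume "i < dim_row (orbit_divisor_matrix H (map ((`) \<phi>) Os))"
      and "j < dim_col (orbit_divisor_matrix H (map ((`) \<phi>) Os))"
    then have ij: "i < length Os" "j < length Os" by (simp_all add: orbit_divisor_matrix_def)
    then have orb: "Os ! i \<in> orbits G" "Os ! j \<in> orbits G"
      using Os nth_mem[of i Os] nth_mem[of j Os] by (simp_all add: orbit_ordering_def)
    obtain u where u: "u \<in> Os ! i" using orbit_nonempty[OF orb(1)] by auto
    have "orbit_divisor_matrix H (map ((`) \<phi>) Os) $$ (i, j) = adjacent_in H (\<phi> u) (\<phi> ` (Os ! j))"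
      using orbit_divisor_matrix_index[OF Ps, of i j "\<phi> u"] ij u by simp
    also have "\<dots> = adjacent_in G u (Os ! j)"
      using orb u by (intro adjacent_in_iso[OF phi]) (auto dest: orbit_subset)
    also have "\<dots> = orbit_divisor_matrix G Os $$ (i, j)"
      using orbit_divisor_matrix_index[OF Os ij u] by simp
    finally show "orbit_divisor_matrix G Os $$ (i, j) =
      orbit_divisor_matrix H (map ((`) \<phi>) Os) $$ (i, j)" by simp
  qed (simp_all add: orbit_divisor_matrix_def)
  moreover have "card (orbits G) = card (orbits H)"
    using inj by (simp add: orbits_iso[OF phi] card_image)
  moreover have "graph_order G = graph_order H"
    unfolding graph_order_def using b by (rule bij_betw_same_card)
  ultimately show ?thesis using Os Ps unfolding orbitally_similar_def by blast
qed

section \<open>Orbital similarity and the orbit distribution\<close>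

text \<open>Arcs come in symmetric pairs, so connectedness gives a directed walk from
  \<open>r\<close> to \<open>v\<close>, and the property travels along its arcs.\<close>

lemma connected_graph_induct [consumes 3, case_names base step]:
  assumes "connected_graph G" "r \<in> pverts G" "v \<in> pverts G"
    and "P r" "\<And>u w. (u, w) \<in> parcs G \<Longrightarrow> P u \<Longrightarrow> P w"
  shows "P v"
proof -
  interpret pair_graph G using assms(1) by (simp add: connected_graph_def)
  have "strongly_connected (with_proj G)"
    using assms(1) symmetric_connected_imp_strongly_connected pair_sym_arcs
    by (simp add: connected_graph_def)
  then have "r \<rightarrow>\<^sup>*\<^bsub>with_proj G\<^esub> v" using assms(2,3) by (auto simp: strongly_connected_def)
  then show ?thesis
    by (induction rule: reachable_induct) (use assms(4,5) in auto)
qed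

lemma orbitally_similar_imp_same_distribution:
  assumes conn: "connected_graph G" "connected_graph H" and "orbitally_similar G H"
  shows "orbit_distribution G = orbit_distribution H"
proof -
  interpret G: pair_graph G using conn by (simp add: connected_graph_def)
  interpret H: pair_graph H using conn by (simp add: connected_graph_def)
  obtain Os Ps where Os: "orbit_ordering G Os" and Ps: "orbit_ordering H Ps"
    and eq: "orbit_divisor_matrix G Os = orbit_divisor_matrix H Ps"
    using assms(3) unfolding orbitally_similar_def by blast
  have len: "length Ps = length Os"
    using arg_cong[OF eq, of dim_row] by (simp add: orbit_divisor_matrix_def)
  define s where "s i j = orbit_divisor_matrix G Os $$ (i, j)" for i j
  have orb: "Os ! i \<in> orbits G" "Ps ! i \<in> orbits H" if "i < length Os" for i
    using that Os Ps len by (auto simp: orbit_ordering_def set_conv_nth)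
  have pos: "card (Os ! i) > 0" "card (Ps ! i) > 0" if "i < length Os" for i
    using orb[OF that] by (simp_all add: card_gt_0_iff orbit_nonempty G.finite_orbit H.finite_orbit)
  \<comment> \<open>The matrices agree, so the orbit sizes of both graphs satisfy the same equations
    with the same coefficients \<open>s\<close>.\<close>
  have balance: "card (Os ! i) * s i k = card (Os ! k) * s k i"
    "card (Ps ! i) * s i k = card (Ps ! k) * s k i"
    if ik: "i < length Os" "k < length Os" for i k
  proof -
    obtain a b where ab: "a \<in> Os ! i" "b \<in> Os ! k"
      using orbit_nonempty[OF orb(1)[OF ik(1)]] orbit_nonempty[OF orb(1)[OF ik(2)]] by auto
    show "card (Os ! i) * s i k = card (Os ! k) * s k i"
      unfolding s_def orbit_divisor_matrix_index[OF Os ik ab(1)]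
        orbit_divisor_matrix_index[OF Os ik(2,1) ab(2)]
      using orb ik ab by (intro G.orbit_double_counting) auto
    obtain c d where cd: "c \<in> Ps ! i" "d \<in> Ps ! k"
      using orbit_nonempty[OF orb(2)[OF ik(1)]] orbit_nonempty[OF orb(2)[OF ik(2)]] by auto
    show "card (Ps ! i) * s i k = card (Ps ! k) * s k i"
      unfolding s_def eq orbit_divisor_matrix_index[OF Ps ik[folded len] cd(1)]
        orbit_divisor_matrix_index[OF Ps ik(2,1)[folded len] cd(2)]
      using orb ik cd by (intro H.orbit_double_counting) auto
  qed
  \<comment> \<open>This says that the quotient of the sizes of the \<open>i\<close>-th orbits does
    not depend on \<open>i\<close>; it is cross-multiplied to stay in the natural numbers.\<close>
  have ratio: "card (Os ! i) * card (Ps ! j) = card (Os ! j) * card (Ps ! i)"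
    if ij: "i < length Os" "j < length Os" for i j
  proof -
    obtain r v where rv: "r \<in> Os ! j" "v \<in> Os ! i"
      using orbit_nonempty[OF orb(1)[OF ij(1)]] orbit_nonempty[OF orb(1)[OF ij(2)]] by auto
    then have "r \<in> pverts G" "v \<in> pverts G"
      using orbit_subset[OF orb(1)[OF ij(1)]] orbit_subset[OF orb(1)[OF ij(2)]] by auto
    \<comment> \<open>The induction runs over vertices along a walk starting in orbit
      \<open>j\<close>, so the claim is stated for whichever index belongs to the orbit of the
      current vertex.\<close>
    with conn(1)
    have "\<forall>i<length Os. v \<in> Os ! i \<longrightarrow> card (Os ! i) * card (Ps ! j) = card (Os ! j) * card (Ps ! i)"
    proof (induction rule: connected_graph_induct)
      case base
      show ?case
      proof (intro allI impI)
        fix i assume i: "i < length Os" "r \<in> Os ! i"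
        then have "Os ! i = Os ! j"
          using orbits_disjoint[OF orb(1)[OF i(1)] orb(1)[OF ij(2)]] rv by auto
        then show "card (Os ! i) * card (Ps ! j) = card (Os ! j) * card (Ps ! i)"
          using Os i ij by (simp add: orbit_ordering_def nth_eq_iff_index_eq)
      qed
    next
      case (step u w)
      show ?case
      proof (intro allI impI)
        fix k assume k: "k < length Os" "w \<in> Os ! k"
        have "u \<in> \<Union> (orbits G)"
          unfolding Union_orbits using step by (simp add: G.in_arcsD1)
        then obtain i where i: "i < length Os" "u \<in> Os ! i"
          using Os by (auto simp: orbit_ordering_def set_conv_nth)
        have "s i k = adjacent_in G u (Os ! k)"
          unfolding s_def using Os i k by (simp add: orbit_divisor_matrix_index)
        moreover have "finite {w \<in> Os ! k. (u, w) \<in> parcs G}" using orb k G.finite_orbit by simp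
        ultimately have "s i k > 0"
          using k step by (auto simp: adjacent_in_def card_gt_0_iff)
        moreover have "card (Os ! i) * card (Ps ! j) = card (Os ! j) * card (Ps ! i)"
          using step(2) i by simp
        \<comment> \<open>The equation for \<open>i\<close> is multiplied by \<open>s i k\<close>;
          the balance equations of both graphs then replace index \<open>i\<close> by
          \<open>k\<close>, and the positive factor \<open>s k i\<close> cancels.\<close>
        then have "(card (Os ! i) * s i k) * card (Ps ! j) = card (Os ! j) * (card (Ps ! i) * s i k)"
          by (simp add: algebra_simps)
        then have "s k i * (card (Os ! k) * card (Ps ! j)) = s k i * (card (Os ! j) * card (Ps ! k))"
          unfolding balance[OF i(1) k(1)] by (simp only: ac_simps)
        moreover have "s k i > 0"
          using balance(1)[OF i(1) k(1)] pos(1)[OF i(1)] \<open>s i k > 0\<close>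
          by (cases "s k i = 0") simp_all
        ultimately show "card (Os ! k) * card (Ps ! j) = card (Os ! j) * card (Ps ! k)" by simp
      qed
    qed
    then show ?thesis using ij rv by simp
  qed
  have frac: "real (card (Os ! i)) / real (graph_order G) = real (card (Ps ! i)) / real (graph_order H)"
    if i: "i < length Os" for i
  proof -
    have oG: "(\<Sum>j<length Os. card (Os ! j)) = graph_order G"
      and oH: "(\<Sum>j<length Os. card (Ps ! j)) = graph_order H"
      using G.sum_card_orbits[OF Os] H.sum_card_orbits[OF Ps] len by auto
    \<comment> \<open>Summing the cross-multiplied equations over all \<open>j\<close> replaces the
      sizes of single orbits by the orders of the graphs.\<close>
    have "card (Os ! i) * graph_order H = (\<Sum>j<length Os. card (Os ! i) * card (Ps ! j))"
      by (simp only: oH[symmetric] sum_distrib_left)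
    also have "\<dots> = (\<Sum>j<length Os. card (Os ! j) * card (Ps ! i))"
      using ratio i by (intro sum.cong) auto
    also have "\<dots> = graph_order G * card (Ps ! i)"
      by (simp only: oG[symmetric] sum_distrib_right)
    finally have "real (card (Os ! i)) * real (graph_order H) =
        real (graph_order G) * real (card (Ps ! i))"
      by (metis of_nat_mult)
    moreover have "graph_order G > 0" "graph_order H > 0"
      using member_le_sum[of i "{..<length Os}" "\<lambda>j. card (Os ! j)"]
        member_le_sum[of i "{..<length Os}" "\<lambda>j. card (Ps ! j)"] pos[OF i] i oG oH by auto
    ultimately show ?thesis by (simp add: field_simps)
  qed
  have "map (\<lambda>A. real (card A) / real (graph_order G)) Os =
      map (\<lambda>A. real (card A) / real (graph_order H)) Ps"
    using frac len by (intro nth_equalityI) auto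
  then have "image_mset (\<lambda>A. real (card A) / real (graph_order G)) (mset Os) =
      image_mset (\<lambda>A. real (card A) / real (graph_order H)) (mset Ps)"
    by (metis mset_map)
  moreover have "mset_set (orbits G) = mset Os" "mset_set (orbits H) = mset Ps"
    using Os Ps mset_set_set[of Os] mset_set_set[of Ps] by (simp_all add: orbit_ordering_def)
  ultimately show ?thesis by (simp add: orbit_distribution_def)
qed

section \<open>Computing orbits, distributions and entropies\<close>

text \<open>Automorphisms preserve degrees, so by the first assumption \<open>f\<close> is constant
  on orbits; the second makes each level set of \<open>f\<close> a single orbit. A free choice of
  \<open>f\<close> allows a more convenient label than the degree itself.\<close>

lemma orbits_degree_classes:
  assumes "\<And>u v. u \<in> pverts G \<Longrightarrow> v \<in> pverts G \<Longrightarrow>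
      adjacent_in G u (pverts G) = adjacent_in G v (pverts G) \<Longrightarrow> f u = f v"
    and "\<And>u v. u \<in> pverts G \<Longrightarrow> v \<in> pverts G \<Longrightarrow> f u = f v \<Longrightarrow>
      \<exists>\<phi>. graph_isomorphism G G \<phi> \<and> \<phi> u = v"
  shows "orbits G = (\<lambda>u. {v \<in> pverts G. f v = f u}) ` pverts G"
proof -
  have "aut_similar G `` {u} = {v \<in> pverts G. f v = f u}" if u: "u \<in> pverts G" for u
  proof (intro equalityI subsetI)
    fix v assume "v \<in> aut_similar G `` {u}"
    then obtain \<phi> where phi: "graph_isomorphism G G \<phi>" "\<phi> u = v" and v: "v \<in> pverts G"
      by (auto simp: aut_similar_def)
    moreover have "\<phi> ` pverts G = pverts G"
      using phi by (simp add: graph_isomorphism_def bij_betw_def)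
    ultimately have "adjacent_in G v (pverts G) = adjacent_in G u (pverts G)"
      using adjacent_in_iso[OF phi(1) u subset_refl] by simp
    then have "f v = f u" by (rule assms(1)[OF v u])
    then show "v \<in> {v \<in> pverts G. f v = f u}" using v by simp
  next
    fix v assume "v \<in> {v \<in> pverts G. f v = f u}"
    then show "v \<in> aut_similar G `` {u}"
      using assms(2)[of u v] u by (auto simp: aut_similar_def)
  qed
  then show ?thesis unfolding orbits_eq by (rule image_cong[OF refl])
qed

context pair_graph
begin

text \<open>Serves to tell distribution vectors apart by the number of orbits alone.\<close>

lemma length_orbit_distribution: "length (orbit_distribution G) = card (orbits G)"
  by (simp add: orbit_distribution_def flip: size_mset)

text \<open>A sum is insensitive to the order of its terms, so sorting the vector can be forgotten
  and the orbits summed over directly.\<close>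

lemma graph_entropy_eq_sum:
  "graph_entropy G = - (\<Sum>A\<in>orbits G. let p = real (card A) / real (graph_order G) in p * log 2 p)"
proof -
  have "(\<Sum>x\<leftarrow>orbit_distribution G. x * log 2 x) =
      \<Sum>\<^sub># (image_mset (\<lambda>x. x * log 2 x) (mset (orbit_distribution G)))"
    by (metis mset_map sum_mset_sum_list)
  then show ?thesis
    by (simp add: graph_entropy_def orbit_distribution_def sum_unfold_sum_mset
        image_mset.compositionality comp_def Let_def)
qed

end

lemma orbit_ordering_single:
  assumes "orbits G = {A}"
  shows "orbit_ordering G Os \<longleftrightarrow> Os = [A]"
proof
  assume "orbit_ordering G Os"
  then have d: "distinct Os" and s: "set Os = {A}" using assms by (auto simp: orbit_ordering_def)
  then have "length Os = Suc 0" using distinct_card[OF d] by simp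
  then obtain B where B: "Os = [B]" by (auto simp: length_Suc_conv)
  show "Os = [A]" using s unfolding B by simp
qed (simp add: orbit_ordering_def assms)

lemma orbit_divisor_matrix_single:
  assumes "orbits G = {A}" "a \<in> A"
  shows "orbit_divisor_matrix G [A] = mat 1 1 (\<lambda>_. adjacent_in G a A)"
proof -
  have "adjacent_in G (SOME u. u \<in> A) A = adjacent_in G a A"
    using assms someI[of "\<lambda>u. u \<in> A" a] by (intro adjacent_in_orbit_eq[of A]) simp_all
  then show ?thesis by (intro eq_matI) (simp_all add: orbit_divisor_matrix_def)
qed

text \<open>A single orbit admits only one ordering, and the divisor matrix is the 1 by 1 matrix
  holding the common degree. Vertex-transitive graphs are thus compared by degree only.\<close>

lemma orbitally_similar_single:
  assumes "orbits G = {A}" "orbits H = {B}" "a \<in> A" "b \<in> B"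
  shows "orbitally_similar G H \<longleftrightarrow> adjacent_in G a A = adjacent_in H b B"
proof -
  have "mat 1 1 (\<lambda>_. x) = mat 1 1 (\<lambda>_. y) \<longleftrightarrow> x = y" for x y :: nat
  proof
    assume eq: "mat 1 1 (\<lambda>_. x) = mat 1 1 (\<lambda>_. y)"
    show "x = y" using arg_cong[OF eq, of "\<lambda>M. M $$ (0, 0)"] by simp
  qed simp
  moreover have "card (orbits G) = card (orbits H)" unfolding assms(1,2) by simp
  ultimately show ?thesis
    unfolding orbitally_similar_def orbit_ordering_single[OF assms(1)]
      orbit_ordering_single[OF assms(2)]
    using orbit_divisor_matrix_single[OF assms(1,3)] orbit_divisor_matrix_single[OF assms(2,4)]
    by auto
qed

lemma orbit_distribution_single:
  assumes "orbits G = {pverts G}" "finite (pverts G)" "pverts G \<noteq> {}"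
  shows "orbit_distribution G = [1]"
  using assms by (simp add: orbit_distribution_def graph_order_def)

section \<open>Graphs on initial segments of the naturals\<close>

text \<open>Symmetrising \<open>R\<close> and removing the diagonal yields a simple undirected graph
  for every \<open>R\<close>, so examples may be given by one-sided relations.\<close>

definition graph_on :: "nat \<Rightarrow> (nat \<Rightarrow> nat \<Rightarrow> bool) \<Rightarrow> nat pair_pre_digraph" where
  "graph_on n R =
     \<lparr>pverts = {..<n}, parcs = {(i, j). i < n \<and> j < n \<and> i \<noteq> j \<and> (R i j \<or> R j i)}\<rparr>"

lemma pverts_graph_on [simp]: "pverts (graph_on n R) = {..<n}"
  by (simp add: graph_on_def)

lemma parcs_graph_on [simp]:
  "(i, j) \<in> parcs (graph_on n R) \<longleftrightarrow> i < n \<and> j < n \<and> i \<noteq> j \<and> (R i j \<or> R j i)"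
  by (simp add: graph_on_def)

lemma graph_order_graph_on [simp]: "graph_order (graph_on n R) = n"
  by (simp add: graph_order_def)

lemma pair_graph_graph_on: "pair_graph (graph_on n R)"
proof unfold_locales
  have "parcs (graph_on n R) \<subseteq> {..<n} \<times> {..<n}" by (auto simp: graph_on_def)
  then show "finite (parcs (graph_on n R))" by (rule finite_subset) simp
  show "symmetric (with_proj (graph_on n R))" by (auto simp: symmetric_def intro!: symI)
qed (auto simp: graph_on_def)

text \<open>Each nonzero vertex has a smaller neighbour, so descending through such neighbours leads
  to 0; by symmetry the walks can also be reversed.\<close>

lemma connected_graph_on:
  assumes "n > 0" and parent: "\<And>v. 0 < v \<Longrightarrow> v < n \<Longrightarrow> \<exists>u<v. R u v \<or> R v u"
  shows "connected_graph (graph_on n R)"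
proof -
  let ?G = "graph_on n R"
  interpret pair_graph ?G by (rule pair_graph_graph_on)
  have *: "0 \<rightarrow>\<^sup>*\<^bsub>with_proj ?G\<^esub> v" if "v < n" for v
    using that
  proof (induction v rule: less_induct)
    case (less v)
    show ?case
    proof (cases "v = 0")
      case False
      then obtain u where u: "u < v" "R u v \<or> R v u" using parent less.prems by blast
      then have "0 \<rightarrow>\<^sup>*\<^bsub>with_proj ?G\<^esub> u" using less by simp
      moreover have "(u, v) \<in> parcs ?G" using u less.prems by simp
      ultimately show ?thesis by (rule reachable_adj_trans)
    qed (use assms(1) in simp)
  qed
  have "Digraph_Component.connected (with_proj ?G)"
  proof (rule connectedI)
    fix u v assume uv: "u \<in> pverts ?G" "v \<in> pverts ?G"
    have "u \<rightarrow>\<^sup>*\<^bsub>with_proj ?G\<^esub> 0"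
      by (rule symmetric_reachable[OF pair_sym_arcs]) (use uv * in simp)
    also have "0 \<rightarrow>\<^sup>*\<^bsub>with_proj ?G\<^esub> v" using uv * by simp
    finally show "u \<rightarrow>\<^sup>*\<^bsub>mk_symmetric (with_proj ?G)\<^esub> v" by (rule reachable_mk_symmetricI)
  qed (use assms(1) in auto)
  then show ?thesis by (simp add: connected_graph_def pair_graph_graph_on)
qed

text \<open>Expresses the degree as the length of an explicit list, which can be computed for
  concrete graphs.\<close>

lemma degree_graph_on:
  "u < n \<Longrightarrow> adjacent_in (graph_on n R) u {..<n} =
     length (filter (\<lambda>w. u \<noteq> w \<and> (R u w \<or> R w u)) [0..<n])"
proof -
  assume "u < n"
  then have "{w \<in> {..<n}. (u, w) \<in> parcs (graph_on n R)} =
      set (filter (\<lambda>w. u \<noteq> w \<and> (R u w \<or> R w u)) [0..<n])" by auto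
  then show ?thesis unfolding adjacent_in_def by (simp only: distinct_card distinct_filter distinct_upt)
qed

section \<open>Circulant graphs\<close>

text \<open>\<open>S\<close> needs just one of the shifts \<open>s\<close> and \<open>-s\<close>,
  since \<open>graph_on\<close> supplies the other.\<close>

definition circulant :: "nat \<Rightarrow> nat set \<Rightarrow> nat pair_pre_digraph" where
  "circulant n S = graph_on n (\<lambda>i j. \<exists>s\<in>S. j = (i + s) mod n)"

lemma rotation_circulant:
  "graph_isomorphism (circulant n S) (circulant n S) (\<lambda>i. (i + a) mod n)"
proof -
  have cancel: "(i + a) mod n = (j + a) mod n \<longleftrightarrow> i mod n = j mod n" for i j
    using cong_add_rcancel_nat[of i a j n] by (simp add: cong_def)
  have inj: "inj_on (\<lambda>i. (i + a) mod n) {..<n}"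
    by (intro inj_onI) (simp add: cancel)
  \<comment> \<open>An injective map of a finite set into itself is onto, by comparing
    cardinalities.\<close>
  have "(\<lambda>i. (i + a) mod n) ` {..<n} = {..<n}"
    by (rule card_subset_eq) (auto simp: card_image[OF inj])
  moreover have "(j + a) mod n = ((i + a) mod n + s) mod n \<longleftrightarrow> j = (i + s) mod n"
    if "j < n" for i j s
    using cancel[of j "i + s"] that by (simp add: mod_simps ac_simps)
  ultimately show ?thesis
    using inj by (auto simp: graph_isomorphism_def bij_betw_def circulant_def cancel)
qed

lemma orbits_circulant:
  assumes "n > 0"
  shows "orbits (circulant n S) = {{..<n}}"
proof -
  have "\<exists>\<phi>. graph_isomorphism (circulant n S) (circulant n S) \<phi> \<and> \<phi> u = v"
    if "u < n" "v < n" for u v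
    \<comment> \<open>The shift takes \<open>u\<close> to \<open>n + v\<close>, which is
      \<open>v\<close> modulo \<open>n\<close>; adding \<open>n - u\<close> instead of subtracting
      \<open>u\<close> avoids truncated subtraction.\<close>
    using that by (intro exI[of _ "\<lambda>i. (i + (n - u + v)) mod n"] conjI rotation_circulant) simp
  then have "aut_similar (circulant n S) `` {u} = {..<n}" if "u < n" for u
    using that by (auto simp: aut_similar_def circulant_def)
  then show ?thesis using assms by (auto simp: orbits_eq circulant_def)
qed

text \<open>With 1 in \<open>S\<close> the vertices form a path through consecutive numbers. The
  alternative \<open>n = 1\<close> admits the one-vertex graph with empty \<open>S\<close>.\<close>

lemma connected_circulant:
  assumes "n > 0" "n = 1 \<or> 1 \<in> S"
  shows "connected_graph (circulant n S)"
  unfolding circulant_def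
proof (rule connected_graph_on)
  fix v assume "0 < v" "v < n"
  then show "\<exists>u<v. (\<exists>s\<in>S. v = (u + s) mod n) \<or> (\<exists>s\<in>S. u = (v + s) mod n)"
    using assms by (intro exI[of _ "v - 1"] conjI disjI1 bexI[of _ 1]) auto
qed (rule assms)

lemma orbitally_similar_circulant:
  assumes "m > 0" "n > 0"
  shows "orbitally_similar (circulant m S) (circulant n T) \<longleftrightarrow>
     adjacent_in (circulant m S) 0 {..<m} = adjacent_in (circulant n T) 0 {..<n}"
  using assms by (intro orbitally_similar_single) (simp_all add: orbits_circulant)

lemma orbit_distribution_circulant: "n > 0 \<Longrightarrow> orbit_distribution (circulant n S) = [1]"
  using orbits_circulant[of n S]
  by (intro orbit_distribution_single) (auto simp: circulant_def)

section \<open>Two graphs with the same entropy\<close>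

text \<open>The even and the odd numbers are the two sides, with \<open>v div 2\<close> the position
  within a side. The degree of \<open>v\<close> is \<open>4 - v div 2\<close>.\<close>

definition half_graph :: "nat pair_pre_digraph" where
  "half_graph = graph_on 8 (\<lambda>u v. even u \<and> odd v \<and> u div 2 + v div 2 \<le> 3)"

text \<open>The weights of 0 to 7 are 0, 1, 2, 2, 2, 2, 3, 4. With threshold 4 the weights 0 to 4
  get the distinct degrees 7, 6, 5, 2, 1.\<close>

definition threshold_weight :: "nat \<Rightarrow> nat" where
  "threshold_weight v = (if v < 2 then v else if v < 6 then 2 else v - 3)"

definition threshold_graph :: "nat pair_pre_digraph" where
  "threshold_graph = graph_on 8 (\<lambda>u v. threshold_weight u + threshold_weight v \<le> 4)"

lemma upt_0_8: "[0..<8] = [0, 1, 2, 3, 4, 5, 6, 7]"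
  by (simp add: upt_rec)

lemma orbits_half_graph: "orbits half_graph = {{0, 1}, {2, 3}, {4, 5}, {6, 7}}"
proof -
  let ?R = "\<lambda>u v :: nat. even u \<and> odd v \<and> u div 2 + v div 2 \<le> 3"
  \<comment> \<open>Exchanging \<open>2 * i\<close> with \<open>2 * i + 1\<close> for all
    \<open>i\<close> at once swaps the two sides and keeps positions, hence preserves
    adjacency.\<close>
  define s :: "nat \<Rightarrow> nat" where "s v = (if even v then v + 1 else v - 1)" for v
  have s: "s (s u) = u" "even (s u) \<longleftrightarrow> odd u" "s u div 2 = u div 2" "s u < 8 \<longleftrightarrow> u < 8" for u
    by (cases "even u"; auto simp: s_def elim!: evenE oddE)+
  have inj: "inj s" by (rule inj_on_inverseI[of _ s]) (rule s(1))
  have "bij_betw s {..<8} {..<8}"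
    by (rule bij_betw_byWitness[where f' = s]) (auto simp: s)
  then have swap: "graph_isomorphism half_graph half_graph s"
    by (auto simp: graph_isomorphism_def half_graph_def s inj_eq[OF inj])
  have id: "graph_isomorphism half_graph half_graph (\<lambda>v. v)"
    by (simp add: graph_isomorphism_def bij_betw_def)
  have deg: "\<forall>u\<in>set [0..<8].
      length (filter (\<lambda>w. u \<noteq> w \<and> (?R u w \<or> ?R w u)) [0..<8]) = 4 - u div 2"
    unfolding upt_0_8 by simp
  have "orbits half_graph =
      (\<lambda>u. {v \<in> pverts half_graph. v div 2 = u div 2}) ` pverts half_graph"
  proof (rule orbits_degree_classes)
    fix u v assume "u \<in> pverts half_graph" "v \<in> pverts half_graph"
    then have uv: "u < 8" "v < 8" by (simp_all add: half_graph_def)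
    show "u div 2 = v div 2"
      if "adjacent_in half_graph u (pverts half_graph) =
          adjacent_in half_graph v (pverts half_graph)"
    proof -
      \<comment> \<open>The truncated subtraction loses nothing, as both quotients are at most
        3.\<close>
      have "4 - u div 2 = 4 - v div 2"
        using that uv deg by (simp add: half_graph_def degree_graph_on)
      then show ?thesis using uv by linarith
    qed
    show "\<exists>\<phi>. graph_isomorphism half_graph half_graph \<phi> \<and> \<phi> u = v" if "u div 2 = v div 2"
    proof (cases "u = v")
      case False
      then have "s u = v" using that
        by (cases "even u"; cases "even v"; auto simp: s_def elim!: evenE oddE)
      then show ?thesis using swap by blast
    qed (use id in blast)
  qed
  also have "\<dots> = (\<lambda>u. set (filter (\<lambda>v. v div 2 = u div 2) [0..<8])) ` set [0..<8]"
    by (rule image_cong) (auto simp: half_graph_def)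
  also have "\<dots> = {{0, 1}, {2, 3}, {4, 5}, {6, 7}}"
    unfolding upt_0_8 by simp
  finally show ?thesis .
qed

lemma orbits_threshold_graph: "orbits threshold_graph = {{0}, {1}, {2, 3, 4, 5}, {6}, {7}}"
proof -
  let ?R = "\<lambda>u v :: nat. threshold_weight u + threshold_weight v \<le> 4"
  \<comment> \<open>Evaluation over all pairs of vertices confirms that equal degrees force equal
    weights.\<close>
  have deg: "\<forall>u\<in>set [0..<8]. \<forall>v\<in>set [0..<8].
      length (filter (\<lambda>w. u \<noteq> w \<and> (?R u w \<or> ?R w u)) [0..<8]) =
        length (filter (\<lambda>w. v \<noteq> w \<and> (?R v w \<or> ?R w v)) [0..<8]) \<longrightarrow>
      threshold_weight u = threshold_weight v"
    by code_simp
  have "orbits threshold_graph =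
      (\<lambda>u. {v \<in> pverts threshold_graph. threshold_weight v = threshold_weight u}) `
        pverts threshold_graph"
  proof (rule orbits_degree_classes)
    fix u v assume "u \<in> pverts threshold_graph" "v \<in> pverts threshold_graph"
    then have uv: "u < 8" "v < 8" by (simp_all add: threshold_graph_def)
    show "threshold_weight u = threshold_weight v"
      if "adjacent_in threshold_graph u (pverts threshold_graph) =
          adjacent_in threshold_graph v (pverts threshold_graph)"
      using that uv deg by (simp add: threshold_graph_def degree_graph_on)
    show "\<exists>\<phi>. graph_isomorphism threshold_graph threshold_graph \<phi> \<and> \<phi> u = v"
      if "threshold_weight u = threshold_weight v"
    \<comment> \<open>Adjacency of distinct vertices depends on their weights alone, so two vertices
      of equal weight may be interchanged with all others fixed.\<close>
    proof (intro exI[of _ "transpose u v"] conjI)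
      show "transpose u v u = v" by simp
      have "threshold_weight (transpose u v w) = threshold_weight w" for w
        using that by (simp add: transpose_def)
      moreover have "bij_betw (transpose u v) {..<8} {..<8}"
        using uv by (simp add: bij_betw_transpose_iff)
      moreover have "transpose u v w < 8 \<longleftrightarrow> w < 8" for w
        using uv by (simp add: transpose_def)
      ultimately show "graph_isomorphism threshold_graph threshold_graph (transpose u v)"
        by (simp add: graph_isomorphism_def threshold_graph_def inj_eq[OF inj_transpose])
    qed
  qed
  also have "\<dots> =
      (\<lambda>u. set (filter (\<lambda>v. threshold_weight v = threshold_weight u) [0..<8])) ` set [0..<8]"
    by (rule image_cong) (auto simp: threshold_graph_def)
  also have "\<dots> = {{0}, {1}, {2, 3, 4, 5}, {6}, {7}}"
    unfolding upt_0_8 by (simp add: threshold_weight_def)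
  finally show ?thesis .
qed

lemma connected_half_graph: "connected_graph half_graph"
  unfolding half_graph_def
proof (rule connected_graph_on)
  fix v :: nat assume "0 < v" "v < 8"
  then show "\<exists>u<v. (even u \<and> odd v \<and> u div 2 + v div 2 \<le> 3) \<or>
      (even v \<and> odd u \<and> v div 2 + u div 2 \<le> 3)"
    \<comment> \<open>Vertices 0 and 1 have position 0 and are adjacent to the whole opposite
      side.\<close>
    by (intro exI[of _ "if even v then 1 else 0"]) auto
qed simp

lemma connected_threshold_graph: "connected_graph threshold_graph"
  unfolding threshold_graph_def
proof (rule connected_graph_on)
  fix v :: nat assume "0 < v" "v < 8"
  then show "\<exists>u<v. threshold_weight u + threshold_weight v \<le> 4 \<or>
      threshold_weight v + threshold_weight u \<le> 4"
    \<comment> \<open>Vertex 0 has weight 0 and is adjacent to every other vertex.\<close>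
    by (intro exI[of _ 0]) (auto simp: threshold_weight_def)
qed simp

text \<open>Four orbits of share 1/4 contribute 1/2 each.\<close>

lemma graph_entropy_half_graph: "graph_entropy half_graph = 2"
proof -
  interpret pair_graph half_graph unfolding half_graph_def by (rule pair_graph_graph_on)
  have "log 2 (1 / 4) = - (2 :: real)" using log_nat_power[of 2 2 2] by (simp add: log_divide)
  moreover have "graph_order half_graph = 8" by (simp add: half_graph_def)
  ultimately show ?thesis
    by (simp add: graph_entropy_eq_sum orbits_half_graph doubleton_eq_iff)
qed

text \<open>The orbit of share 1/2 contributes 1/2, and each of the four orbits of share 1/8
  contributes 3/8.\<close>

lemma graph_entropy_threshold_graph: "graph_entropy threshold_graph = 2"
proof -
  interpret pair_graph threshold_graph unfolding threshold_graph_def by (rule pair_graph_graph_on)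
  have "log 2 (1 / 8) = - (3 :: real)" using log_nat_power[of 2 2 3] by (simp add: log_divide)
  moreover have "log 2 (1 / 2) = - (1 :: real)" by (simp add: log_divide)
  moreover have "graph_order threshold_graph = 8" by (simp add: threshold_graph_def)
  ultimately show ?thesis
    by (simp add: graph_entropy_eq_sum orbits_threshold_graph)
qed

section \<open>Separating the four pairs of conditions\<close>

text \<open>An isomorphism would carry the triangle 0, 1, 2 into a graph whose edges all join an
  even to an odd number.\<close>

lemma circulant_8_not_isomorphic: "\<not> isomorphic (circulant 8 {1, 2}) (circulant 8 {1, 3})"
proof
  assume "isomorphic (circulant 8 {1, 2}) (circulant 8 {1, 3})"
  then obtain \<phi> where phi: "graph_isomorphism (circulant 8 {1, 2}) (circulant 8 {1, 3}) \<phi>"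
    by (auto simp: circulant_def isomorphic_iff pair_graph_graph_on)
  have "(\<phi> u, \<phi> v) \<in> parcs (circulant 8 {1, 3})" if "(u, v) \<in> parcs (circulant 8 {1, 2})" for u v
    using phi that by (auto simp: graph_isomorphism_def circulant_def)
  moreover have "(0, 1) \<in> parcs (circulant 8 {1, 2})" "(1, 2) \<in> parcs (circulant 8 {1, 2})"
    "(0, 2) \<in> parcs (circulant 8 {1, 2})"
    by (simp_all add: circulant_def)
  moreover have "even u \<longleftrightarrow> odd v" if "(u, v) \<in> parcs (circulant 8 {1, 3})" for u v
  proof -
    have "u = (v + 1) mod 8 \<or> u = (v + 3) mod 8 \<or> v = (u + 1) mod 8 \<or> v = (u + 3) mod 8"
      using that by (auto simp: circulant_def)
    \<comment> \<open>Odd shifts change parity, and reduction modulo the even number 8 keeps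
      it.\<close>
    moreover have "even (x mod 8) \<longleftrightarrow> even x" for x :: nat by (simp add: dvd_mod_iff)
    ultimately show ?thesis by (elim disjE) simp_all
  qed
  ultimately have "even (\<phi> 0) \<longleftrightarrow> odd (\<phi> 1)" "even (\<phi> 1) \<longleftrightarrow> odd (\<phi> 2)"
    "even (\<phi> 0) \<longleftrightarrow> odd (\<phi> 2)"
    by simp_all
  then show False by (cases "even (\<phi> 0)") simp_all
qed

theorem theorem1:
  shows
    "(\<forall>(G :: 'a pair_pre_digraph) (H :: 'b pair_pre_digraph).
        connected_graph G \<and> connected_graph H \<longrightarrow>
          (isomorphic G H \<longrightarrow> orbitally_similar G H \<and> graph_order G = graph_order H) \<and>
          (orbitally_similar G H \<and> graph_order G = graph_order H \<longrightarrow> orbitally_similar G H) \<and>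
          (orbitally_similar G H \<longrightarrow> orbit_distribution G = orbit_distribution H) \<and>
          (orbit_distribution G = orbit_distribution H \<longrightarrow> graph_entropy G = graph_entropy H)) \<and>
     (\<exists>(G :: nat pair_pre_digraph) (H :: nat pair_pre_digraph).
        connected_graph G \<and> connected_graph H \<and>
        (orbitally_similar G H \<and> graph_order G = graph_order H) \<and> \<not> isomorphic G H) \<and>
     (\<exists>(G :: nat pair_pre_digraph) (H :: nat pair_pre_digraph).
        connected_graph G \<and> connected_graph H \<and>
        orbitally_similar G H \<and> \<not> (orbitally_similar G H \<and> graph_order G = graph_order H)) \<and>
     (\<exists>(G :: nat pair_pre_digraph) (H :: nat pair_pre_digraph).
        connected_graph G \<and> connected_graph H \<and>
        orbit_distribution G = orbit_distribution H \<and> \<not> orbitally_similar G H) \<and>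
     (\<exists>(G :: nat pair_pre_digraph) (H :: nat pair_pre_digraph).
        connected_graph G \<and> connected_graph H \<and>
        graph_entropy G = graph_entropy H \<and> orbit_distribution G \<noteq> orbit_distribution H)"
proof (intro conjI allI impI)
  fix G :: "'a pair_pre_digraph" and H :: "'b pair_pre_digraph"
  assume GH: "connected_graph G \<and> connected_graph H"
  then have pg: "pair_graph G" "pair_graph H" by (simp_all add: connected_graph_def)
  show "orbitally_similar G H" "graph_order G = graph_order H" if "isomorphic G H"
    using isomorphic_imp_orbitally_similar[OF pg that] by simp_all
  show "orbitally_similar G H" if "orbitally_similar G H \<and> graph_order G = graph_order H"
    using that by simp
  show "orbit_distribution G = orbit_distribution H" if "orbitally_similar G H"
    using GH that by (simp add: orbitally_similar_imp_same_distribution)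
  show "graph_entropy G = graph_entropy H" if "orbit_distribution G = orbit_distribution H"
    using that by (simp add: graph_entropy_def)
next
  \<comment> \<open>Both graphs are vertex-transitive of degree 4.\<close>
  have "orbitally_similar (circulant 8 {1, 2}) (circulant 8 {1, 3})"
    by (subst orbitally_similar_circulant; simp add: circulant_def degree_graph_on upt_0_8)
  moreover have "graph_order (circulant 8 {1, 2}) = graph_order (circulant 8 {1, 3})"
    by (simp add: circulant_def)
  ultimately show "\<exists>(G :: nat pair_pre_digraph) (H :: nat pair_pre_digraph).
      connected_graph G \<and> connected_graph H \<and>
      (orbitally_similar G H \<and> graph_order G = graph_order H) \<and> \<not> isomorphic G H"
    using circulant_8_not_isomorphic connected_circulant[of 8 "{1, 2}"]
      connected_circulant[of 8 "{1, 3}"]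
    by (intro exI[of _ "circulant 8 {1, 2}"] exI[of _ "circulant 8 {1, 3}"]) simp
next
  \<comment> \<open>Both cycles are vertex-transitive of degree 2.\<close>
  have "orbitally_similar (circulant 3 {1}) (circulant 4 {1})"
    by (subst orbitally_similar_circulant; simp add: circulant_def degree_graph_on upt_rec)
  moreover have "graph_order (circulant 3 {1}) \<noteq> graph_order (circulant 4 {1})"
    by (simp add: circulant_def)
  ultimately show "\<exists>(G :: nat pair_pre_digraph) (H :: nat pair_pre_digraph).
      connected_graph G \<and> connected_graph H \<and>
      orbitally_similar G H \<and> \<not> (orbitally_similar G H \<and> graph_order G = graph_order H)"
    using connected_circulant[of 3 "{1}"] connected_circulant[of 4 "{1}"]
    by (intro exI[of _ "circulant 3 {1}"] exI[of _ "circulant 4 {1}"]) simp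
next
  \<comment> \<open>The degrees are 0 and 1, while both distribution vectors consist of the single
    entry 1.\<close>
  have "\<not> orbitally_similar (circulant 1 {}) (circulant 2 {1})"
    by (subst orbitally_similar_circulant; simp add: circulant_def degree_graph_on upt_rec)
  moreover have "orbit_distribution (circulant 1 {}) = orbit_distribution (circulant 2 {1})"
    by (simp add: orbit_distribution_circulant)
  ultimately show "\<exists>(G :: nat pair_pre_digraph) (H :: nat pair_pre_digraph).
      connected_graph G \<and> connected_graph H \<and>
      orbit_distribution G = orbit_distribution H \<and> \<not> orbitally_similar G H"
    using connected_circulant[of 1 "{}"] connected_circulant[of 2 "{1}"]
    by (intro exI[of _ "circulant 1 {}"] exI[of _ "circulant 2 {1}"]) simp
next
  have "pair_graph half_graph" "pair_graph threshold_graph"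
    by (simp_all add: half_graph_def threshold_graph_def pair_graph_graph_on)
  then have "length (orbit_distribution half_graph) = 4"
    "length (orbit_distribution threshold_graph) = 5"
    by (simp_all add: pair_graph.length_orbit_distribution orbits_half_graph
        orbits_threshold_graph doubleton_eq_iff)
  then have "orbit_distribution half_graph \<noteq> orbit_distribution threshold_graph" by auto
  then show "\<exists>(G :: nat pair_pre_digraph) (H :: nat pair_pre_digraph).
      connected_graph G \<and> connected_graph H \<and>
      graph_entropy G = graph_entropy H \<and> orbit_distribution G \<noteq> orbit_distribution H"
    using connected_half_graph connected_threshold_graph graph_entropy_half_graph
      graph_entropy_threshold_graph by metis
qed

end
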